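(* Let $A$ be a unital complex Banach algebra and let $a\in\mathcal{V}(A)$ be such that its Moore-Penrose inverse $a^{\dag}$ exists. Then $a$ is normal if and only if $a$ is EP and $a^{\dag}a^*=a^*a^{\dag}$.
   Context: Let $A$ be a unital complex Banach algebra. An element $h\in A$ is hermitian if $\|\exp(ith)\|=1$ for all $t\in\mathbb{R}$; $\mathcal{H}(A)$ denotes the set of hermitian elements of $A$, and $\mathcal{V}(A)=\mathcal{H}(A)+i\mathcal{H}(A)$. Each $a\in\mathcal{V}(A)$ has a unique representation $a=u+iv$ with $u,v\in\mathcal{H}(A)$, and one sets $a^*=u-iv$ (this operation on $\mathcal{V}(A)$ is not in general an algebra involution; in particular $(ab)^*=b^*a^*$ may fail). The element $a=u+iv\in\mathcal{V}(A)$ is normal if $uv=vu$ (equivalently, $aa^*=a^*a$). Given $a\in A$, an element $x\in A$ is the Moore-Penrose inverse of $a$, denoted $a^{\dag}$, if $a=axa$, $x=xax$, and both $ax$ and $xa$ are hermitian; there is at most one such $x$. An element $a\in A$ is EP if $a^{\dag}$ exists and $aa^{\dag}=a^{\dag}a$. *)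

theory Defs
  imports Complex_Main
begin

text \<open>
  Unital complex Banach algebras, as an extension of the real ones. The superclass requires
  \<open>norm 1 = 1\<close>; this loses no generality for hermitian elements, since any hermitian \<open>h\<close> gives
  \<open>norm 1 = norm (exp (i 0 h)) = 1\<close>.
\<close>

class complex_banach_algebra_1 = real_normed_algebra_1 + banach +
  fixes scaleC :: "complex \<Rightarrow> 'a \<Rightarrow> 'a"  (infixr \<open>*\<^sub>C\<close> 75)
  assumes scaleC_add_right: "c *\<^sub>C (x + y) = c *\<^sub>C x + c *\<^sub>C y"
    and scaleC_add_left: "(c + d) *\<^sub>C x = c *\<^sub>C x + d *\<^sub>C x"
    and scaleC_scaleC: "c *\<^sub>C (d *\<^sub>C x) = (c * d) *\<^sub>C x"
    and scaleC_of_real: "complex_of_real r *\<^sub>C x = r *\<^sub>R x"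
    and mult_scaleC_left: "(c *\<^sub>C x) * y = c *\<^sub>C (x * y)"
    and mult_scaleC_right: "x * (c *\<^sub>C y) = c *\<^sub>C (x * y)"
    and norm_scaleC: "norm (c *\<^sub>C x) = cmod c * norm x"

instantiation complex :: complex_banach_algebra_1
begin

definition scaleC_complex :: "complex \<Rightarrow> complex \<Rightarrow> complex"
  where "scaleC_complex c x = c * x"

instance
  by standard
    (simp_all add: scaleC_complex_def algebra_simps norm_mult scaleR_conv_of_real)

end

definition hermitian :: "'a::complex_banach_algebra_1 \<Rightarrow> bool"
  where "hermitian h \<longleftrightarrow> (\<forall>t::real. norm (exp ((\<i> * complex_of_real t) *\<^sub>C h)) = 1)"

definition hermitian_span :: "'a::complex_banach_algebra_1 set"  (\<open>\<V>\<close>)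
  where "\<V> = {u + \<i> *\<^sub>C v | u v. hermitian u \<and> hermitian v}"

text \<open>
  The representation \<open>a = u + i v\<close> with hermitian \<open>u\<close>, \<open>v\<close> is unique for \<open>a \<in> \<V>\<close>, so the
  description below is proper there; \<open>star a\<close> carries no meaning for \<open>a \<notin> \<V>\<close>.
\<close>

definition star :: "'a::complex_banach_algebra_1 \<Rightarrow> 'a"
  where "star a = (THE b. \<exists>u v. hermitian u \<and> hermitian v \<and>
                            a = u + \<i> *\<^sub>C v \<and> b = u - \<i> *\<^sub>C v)"

definition normal_element :: "'a::complex_banach_algebra_1 \<Rightarrow> bool"
  where "normal_element a \<longleftrightarrow>
    (\<exists>u v. hermitian u \<and> hermitian v \<and> a = u + \<i> *\<^sub>C v \<and> u * v = v * u)"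

definition is_MP_inverse :: "'a::complex_banach_algebra_1 \<Rightarrow> 'a \<Rightarrow> bool"
  where "is_MP_inverse a x \<longleftrightarrow>
    a = a * x * a \<and> x = x * a * x \<and> hermitian (a * x) \<and> hermitian (x * a)"

definition MP_invertible :: "'a::complex_banach_algebra_1 \<Rightarrow> bool"
  where "MP_invertible a \<longleftrightarrow> (\<exists>x. is_MP_inverse a x)"

text \<open>There is at most one Moore-Penrose inverse; it is only meaningful if \<open>MP_invertible a\<close>.\<close>

definition MP_inverse :: "'a::complex_banach_algebra_1 \<Rightarrow> 'a"  (\<open>(_\<^sup>\<dagger>)\<close> [1000] 999)
  where "a\<^sup>\<dagger> = (THE x. is_MP_inverse a x)"

definition EP :: "'a::complex_banach_algebra_1 \<Rightarrow> bool"
  where "EP a \<longleftrightarrow> MP_invertible a \<and> a * a\<^sup>\<dagger> = a\<^sup>\<dagger> * a"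

end

theory Submission
  imports Defs "HOL-Analysis.Analysis"
begin

text \<open>
  Write \<open>a = u + i v\<close> with \<open>u\<close>, \<open>v\<close> hermitian, \<open>a\<^sup>* = u - i v\<close>, and let \<open>x\<close> be the Moore-Penrose
  inverse of \<open>a\<close>. Since \<open>(a b)\<^sup>* = b\<^sup>* a\<^sup>*\<close> is not available, the usual algebra with stars is
  replaced by facts about hermitian elements alone: they form a closed real subspace, and
  \<open>i (h k - k h)\<close> is hermitian whenever \<open>h\<close> and \<open>k\<close> are (\<open>hermitian_commutator\<close>). A hermitian
  element of square zero vanishes, because \<open>exp (i t h) = 1 + i t h\<close> is bounded in \<open>t\<close>. Applied to a
  commutator, this shows that for a hermitian idempotent \<open>p\<close> and a hermitian \<open>u\<close> the equations
  \<open>p u = u\<close> and \<open>u p = u\<close> are equivalent (\<open>hermitian_idempotent_absorbs\<close>). This equivalence does the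
  work that taking adjoints does in a C*-algebra, and in particular makes \<open>x\<close> unique.

  The second tool is a one-sided form of Fuglede's theorem: if \<open>u v = v u\<close>, then \<open>a b = 0\<close> implies
  \<open>a\<^sup>* b = 0\<close>, and likewise on the other side. It also yields the uniqueness of \<open>u\<close> and \<open>v\<close>.

  If \<open>a\<close> is normal, put \<open>p = a x\<close> and \<open>q = x a\<close>. From \<open>a (1 - q) = 0\<close> Fuglede gives \<open>u q = u\<close> and
  \<open>v q = v\<close>, hence \<open>q u = u\<close>, \<open>q v = v\<close> and \<open>q a = a\<close>; symmetrically \<open>a p = a\<close>. Then
  \<open>p = q p = q\<close>, so that \<open>a\<close> is EP.

  If \<open>a\<close> is EP, then \<open>p = a x = x a\<close> commutes with \<open>a\<close>. The two hermitian elements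
  \<open>i (p u - u p)\<close> and \<open>i (p v - v p)\<close> are the parts of \<open>i (p a - a p) = 0\<close>, so both vanish and \<open>p\<close>
  commutes with \<open>a\<^sup>*\<close>. Because \<open>a\<close> and \<open>x\<close> are mutually inverse relative to the unit \<open>p\<close>, the element
  \<open>a\<^sup>*\<close> commutes with \<open>x\<close> if and only if it commutes with \<open>a\<close>, and the latter is normality.
\<close>

section \<open>Complex scalars\<close>

lemma scaleC_zero_left [simp]: "0 *\<^sub>C x = (0::'a::complex_banach_algebra_1)"
  using scaleC_of_real[of 0 x] by simp

lemma scaleC_one [simp]: "1 *\<^sub>C x = (x::'a::complex_banach_algebra_1)"
  using scaleC_of_real[of 1 x] by simp

lemma scaleC_zero_right [simp]: "c *\<^sub>C 0 = (0::'a::complex_banach_algebra_1)"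
  using norm_scaleC[of c "0::'a"] by simp

lemma scaleC_minus_left: "(- c) *\<^sub>C x = - (c *\<^sub>C (x::'a::complex_banach_algebra_1))"
  using scaleC_add_left[of "- c" c x] by (simp add: eq_neg_iff_add_eq_0)

lemma scaleC_minus_right: "c *\<^sub>C (- x) = - (c *\<^sub>C (x::'a::complex_banach_algebra_1))"
  using scaleC_add_right[of c "- x" x] by (simp add: eq_neg_iff_add_eq_0)

lemma scaleC_diff_right: "c *\<^sub>C (x - y) = c *\<^sub>C x - c *\<^sub>C (y::'a::complex_banach_algebra_1)"
  using scaleC_add_right[of c x "- y"] by (simp add: scaleC_minus_right)

lemma scaleC_diff_left: "(c - d) *\<^sub>C x = c *\<^sub>C x - d *\<^sub>C (x::'a::complex_banach_algebra_1)"
  using scaleC_add_left[of c "- d" x] by (simp add: scaleC_minus_left)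

lemma scaleC_scaleR: "c *\<^sub>C (r *\<^sub>R x) = r *\<^sub>R (c *\<^sub>C (x::'a::complex_banach_algebra_1))"
  by (simp add: scaleC_of_real[symmetric] scaleC_scaleC mult.commute)

lemma scaleR_scaleC: "r *\<^sub>R (c *\<^sub>C x) = (of_real r * c) *\<^sub>C (x::'a::complex_banach_algebra_1)"
  by (simp add: scaleC_of_real[symmetric] scaleC_scaleC)

lemma scaleC_eq_0_iff: "c *\<^sub>C x = 0 \<longleftrightarrow> c = 0 \<or> x = (0::'a::complex_banach_algebra_1)"
  using norm_scaleC[of c x] by (metis mult_eq_0_iff norm_eq_zero)

lemma scaleC_power: "(c *\<^sub>C x) ^ n = c ^ n *\<^sub>C (x::'a::complex_banach_algebra_1) ^ n"
  by (induction n) (simp_all add: mult_scaleC_left mult_scaleC_right scaleC_scaleC mult.commute)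

lemma scaleC_sum_right: "c *\<^sub>C sum f I = (\<Sum>i\<in>I. c *\<^sub>C (f i :: 'a::complex_banach_algebra_1))"
  by (induction I rule: infinite_finite_induct) (simp_all add: scaleC_add_right)

lemma scaleC_sum_left: "sum c I *\<^sub>C (x::'a::complex_banach_algebra_1) = (\<Sum>i\<in>I. c i *\<^sub>C x)"
  by (induction I rule: infinite_finite_induct) (simp_all add: scaleC_add_left)

section \<open>Hermitian elements\<close>

lemma hermitian_iff_norm_exp:
  "hermitian h \<longleftrightarrow> (\<forall>t::real. norm (exp (t *\<^sub>R (\<i> *\<^sub>C h))) = 1)"
  by (simp add: hermitian_def scaleR_scaleC mult.commute)

lemma hermitian_norm_exp: "hermitian h \<Longrightarrow> norm (exp (\<i> *\<^sub>C h)) = 1"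
  using hermitian_iff_norm_exp[of h] by (metis scaleR_one)

lemma norm_exp_nat_scaleR_le:
  fixes x :: "'a::{real_normed_algebra_1,banach}"
  shows "norm (exp (real n *\<^sub>R x)) \<le> norm (exp x) ^ n"
proof (induction n)
  case (Suc n)
  have "exp (real (Suc n) *\<^sub>R x) = exp x * exp (real n *\<^sub>R x)"
    by (subst exp_add_commuting[symmetric]) (simp_all add: algebra_simps)
  then have "norm (exp (real (Suc n) *\<^sub>R x)) \<le> norm (exp x) * norm (exp (real n *\<^sub>R x))"
    by (simp add: norm_mult_ineq)
  also have "\<dots> \<le> norm (exp x) * norm (exp x) ^ n"
    by (rule mult_left_mono[OF Suc]) simp
  finally show ?case by simp
qed simp

lemma exp_first_order:
  fixes x :: "'a::{real_normed_algebra_1,banach}"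
  assumes "e > 0"
  shows "\<exists>d>0. \<forall>t. \<bar>t\<bar> < d \<longrightarrow> norm (exp (t *\<^sub>R x) - (1 + t *\<^sub>R x)) \<le> e * \<bar>t\<bar>"
proof -
  have "((\<lambda>t. exp (t *\<^sub>R x)) has_derivative (\<lambda>t. t *\<^sub>R x)) (at 0)"
    using exp_scaleR_has_vector_derivative_right[of x 0 UNIV]
    by (simp add: has_vector_derivative_def)
  with assms show ?thesis
    unfolding has_derivative_at_alt by (simp add: diff_diff_eq)
qed

text \<open>
  Reality of the numerical range, stated through \<open>norm (1 + i t h) \<le> 1 + o(t)\<close>. Unlike
  \<open>exp (i t h)\<close>, the element \<open>1 + i t h\<close> is affine in \<open>h\<close>, which is what makes sums and limits
  tractable even when the elements do not commute. For the converse, \<open>norm (exp (t x))\<close> is at most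
  \<open>norm (exp (t x / n)) ^ n \<le> (1 + 2 e \<bar>t\<bar> / n) ^ n\<close>, which stays below \<open>exp (2 e \<bar>t\<bar>)\<close>.
\<close>

lemma hermitian_iff_first_order:
  "hermitian h \<longleftrightarrow>
    (\<forall>e>0. \<exists>d>0. \<forall>t. \<bar>t\<bar> < d \<longrightarrow> norm (1 + t *\<^sub>R (\<i> *\<^sub>C h)) \<le> 1 + e * \<bar>t\<bar>)"
    (is "_ \<longleftrightarrow> ?R")
proof
  assume h: "hermitian h"
  show ?R
  proof (intro allI impI)
    fix e :: real assume "e > 0"
    then obtain d where d: "d > 0"
      "\<And>t. \<bar>t\<bar> < d \<Longrightarrow> norm (exp (t *\<^sub>R (\<i> *\<^sub>C h)) - (1 + t *\<^sub>R (\<i> *\<^sub>C h))) \<le> e * \<bar>t\<bar>"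
      using exp_first_order by blast
    have "norm (1 + t *\<^sub>R (\<i> *\<^sub>C h)) \<le> 1 + e * \<bar>t\<bar>" if "\<bar>t\<bar> < d" for t
    proof -
      have "norm (exp (t *\<^sub>R (\<i> *\<^sub>C h))) = 1" using h hermitian_iff_norm_exp by blast
      with d(2)[OF that] show ?thesis
        using norm_triangle_sub[of "1 + t *\<^sub>R (\<i> *\<^sub>C h)" "exp (t *\<^sub>R (\<i> *\<^sub>C h))"]
        by (simp add: norm_minus_commute)
    qed
    with d(1) show "\<exists>d>0. \<forall>t. \<bar>t\<bar> < d \<longrightarrow> norm (1 + t *\<^sub>R (\<i> *\<^sub>C h)) \<le> 1 + e * \<bar>t\<bar>" by blast
  qed
next
  assume R: ?R
  define x where "x = \<i> *\<^sub>C h"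
  have le_exp: "norm (exp (t *\<^sub>R x)) \<le> exp (2 * e * \<bar>t\<bar>)" if "e > 0" for t e :: real
  proof -
    obtain d1 where d1: "d1 > 0" "\<And>t. \<bar>t\<bar> < d1 \<Longrightarrow> norm (1 + t *\<^sub>R x) \<le> 1 + e * \<bar>t\<bar>"
      using R \<open>e > 0\<close> x_def by blast
    obtain d2 where d2: "d2 > 0"
      "\<And>t. \<bar>t\<bar> < d2 \<Longrightarrow> norm (exp (t *\<^sub>R x) - (1 + t *\<^sub>R x)) \<le> e * \<bar>t\<bar>"
      using exp_first_order \<open>e > 0\<close> by blast
    obtain n :: nat where n: "n > 0" "\<bar>t\<bar> / real n < min d1 d2"
    proof -
      define m where "m = min d1 d2"
      have "m > 0" using d1(1) d2(1) by (simp add: m_def)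
      moreover obtain k :: nat where "\<bar>t\<bar> / m < real k" using reals_Archimedean2 by blast
      ultimately have "\<bar>t\<bar> / real (Suc k) < m"
        by (simp add: field_simps)
      then show ?thesis using that[of "Suc k"] by (simp add: m_def)
    qed
    define s where "s = t / real n"
    have s: "\<bar>s\<bar> < d1" "\<bar>s\<bar> < d2" "t = real n * s" using n by (auto simp: s_def)
    have "norm (exp (s *\<^sub>R x)) \<le> norm (1 + s *\<^sub>R x) + norm (exp (s *\<^sub>R x) - (1 + s *\<^sub>R x))"
      by (rule norm_triangle_sub)
    also have "\<dots> \<le> 1 + 2 * e * \<bar>s\<bar>" using d1(2)[OF s(1)] d2(2)[OF s(2)] by simp
    also have "\<dots> \<le> exp (2 * e * \<bar>s\<bar>)" by (rule exp_ge_add_one_self)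
    finally have "norm (exp (s *\<^sub>R x)) ^ n \<le> exp (2 * e * \<bar>s\<bar>) ^ n" by (rule power_mono) simp
    also have "\<dots> = exp (2 * e * \<bar>t\<bar>)"
      by (simp add: exp_of_nat_mult[symmetric] s(3) abs_mult ac_simps)
    finally show ?thesis
      using norm_exp_nat_scaleR_le[of n "s *\<^sub>R x"] by (simp add: s(3))
  qed
  have le1: "norm (exp (t *\<^sub>R x)) \<le> 1" for t :: real
  proof (rule tendsto_lowerbound)
    show "((\<lambda>e. exp (2 * e * \<bar>t\<bar>)) \<longlongrightarrow> 1) (at_right 0)"
      by (auto intro!: tendsto_eq_intros)
    show "\<forall>\<^sub>F e in at_right 0. norm (exp (t *\<^sub>R x)) \<le> exp (2 * e * \<bar>t\<bar>)"
      using le_exp by (auto simp: eventually_at_filter)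
  qed simp
  \<comment> \<open>The bound for both \<open>t\<close> and \<open>- t\<close> forces equality, since the two exponentials are inverse.\<close>
  show "hermitian h"
    unfolding hermitian_iff_norm_exp x_def[symmetric]
  proof (intro allI antisym le1)
    fix t :: real
    have "1 = norm (exp (t *\<^sub>R x) * exp ((- t) *\<^sub>R x))"
      using exp_minus_inverse[of "t *\<^sub>R x"] by simp
    also have "\<dots> \<le> norm (exp (t *\<^sub>R x)) * norm (exp ((- t) *\<^sub>R x))" by (rule norm_mult_ineq)
    also have "\<dots> \<le> norm (exp (t *\<^sub>R x))" by (rule mult_left_le[OF le1]) simp
    finally show "1 \<le> norm (exp (t *\<^sub>R x))" .
  qed
qed

lemma hermitian_scaleR: "hermitian h \<Longrightarrow> hermitian (r *\<^sub>R h)"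
  by (simp add: hermitian_iff_norm_exp scaleC_scaleR)

lemma hermitian_minus: "hermitian h \<Longrightarrow> hermitian (- h)"
  using hermitian_scaleR[of h "-1"] by simp

text \<open>\<open>1 + i t (h + k)\<close> is the midpoint of \<open>1 + 2 i t h\<close> and \<open>1 + 2 i t k\<close>.\<close>

lemma hermitian_add:
  assumes "hermitian h" "hermitian k"
  shows "hermitian (h + k)"
  unfolding hermitian_iff_first_order
proof (intro allI impI)
  fix e :: real assume "e > 0"
  then have e2: "e / 2 > 0" by simp
  obtain d1 where d1: "d1 > 0"
    "\<And>t. \<bar>t\<bar> < d1 \<Longrightarrow> norm (1 + t *\<^sub>R (\<i> *\<^sub>C h)) \<le> 1 + e / 2 * \<bar>t\<bar>"
    using assms(1) e2 unfolding hermitian_iff_first_order by blast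
  obtain d2 where d2: "d2 > 0"
    "\<And>t. \<bar>t\<bar> < d2 \<Longrightarrow> norm (1 + t *\<^sub>R (\<i> *\<^sub>C k)) \<le> 1 + e / 2 * \<bar>t\<bar>"
    using assms(2) e2 unfolding hermitian_iff_first_order by blast
  have "norm (1 + t *\<^sub>R (\<i> *\<^sub>C (h + k))) \<le> 1 + e * \<bar>t\<bar>" if "\<bar>t\<bar> < min d1 d2 / 2" for t
  proof -
    have eq: "2 *\<^sub>R (1 + t *\<^sub>R (\<i> *\<^sub>C (h + k)))
      = (1 + (2 * t) *\<^sub>R (\<i> *\<^sub>C h)) + (1 + (2 * t) *\<^sub>R (\<i> *\<^sub>C k))"
      by (simp add: scaleC_add_right scaleR_2 algebra_simps)
    have "2 * norm (1 + t *\<^sub>R (\<i> *\<^sub>C (h + k))) = norm (2 *\<^sub>R (1 + t *\<^sub>R (\<i> *\<^sub>C (h + k))))"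
      by simp
    also have "\<dots> \<le> norm (1 + (2 * t) *\<^sub>R (\<i> *\<^sub>C h)) + norm (1 + (2 * t) *\<^sub>R (\<i> *\<^sub>C k))"
      unfolding eq by (rule norm_triangle_ineq)
    also have "\<dots> \<le> 2 * (1 + e * \<bar>t\<bar>)"
      using d1(2)[of "2 * t"] d2(2)[of "2 * t"] that by (simp add: abs_mult)
    finally show ?thesis by simp
  qed
  moreover have "min d1 d2 / 2 > 0" using d1(1) d2(1) by simp
  ultimately show "\<exists>d>0. \<forall>t. \<bar>t\<bar> < d \<longrightarrow> norm (1 + t *\<^sub>R (\<i> *\<^sub>C (h + k))) \<le> 1 + e * \<bar>t\<bar>"
    by blast
qed

lemma hermitian_diff: "hermitian h \<Longrightarrow> hermitian k \<Longrightarrow> hermitian (h - k)"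
  using hermitian_add[of h "- k"] hermitian_minus[of k] by simp

lemma hermitian_approx:
  assumes "\<And>e. e > 0 \<Longrightarrow> \<exists>k. hermitian k \<and> norm (h - k) \<le> e"
  shows "hermitian h"
  unfolding hermitian_iff_first_order
proof (intro allI impI)
  fix e :: real assume "e > 0"
  then have e2: "e / 2 > 0" by simp
  obtain k where k: "hermitian k" "norm (h - k) \<le> e / 2" using assms e2 by blast
  obtain d where d: "d > 0"
    "\<And>t. \<bar>t\<bar> < d \<Longrightarrow> norm (1 + t *\<^sub>R (\<i> *\<^sub>C k)) \<le> 1 + e / 2 * \<bar>t\<bar>"
    using k(1) e2 unfolding hermitian_iff_first_order by blast
  have "norm (1 + t *\<^sub>R (\<i> *\<^sub>C h)) \<le> 1 + e * \<bar>t\<bar>" if "\<bar>t\<bar> < d" for t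
  proof -
    have eq: "1 + t *\<^sub>R (\<i> *\<^sub>C h) = (1 + t *\<^sub>R (\<i> *\<^sub>C k)) + t *\<^sub>R (\<i> *\<^sub>C (h - k))"
      by (simp add: scaleC_diff_right algebra_simps)
    have "norm (1 + t *\<^sub>R (\<i> *\<^sub>C h))
      \<le> norm (1 + t *\<^sub>R (\<i> *\<^sub>C k)) + norm (t *\<^sub>R (\<i> *\<^sub>C (h - k)))"
      unfolding eq by (rule norm_triangle_ineq)
    also have "\<dots> \<le> (1 + e / 2 * \<bar>t\<bar>) + \<bar>t\<bar> * (e / 2)"
      using d(2)[OF that] mult_left_mono[OF k(2), of "\<bar>t\<bar>"] by (intro add_mono) (simp_all add: norm_scaleC)
    finally show ?thesis by (simp add: algebra_simps)
  qed
  with d(1) show "\<exists>d>0. \<forall>t. \<bar>t\<bar> < d \<longrightarrow> norm (1 + t *\<^sub>R (\<i> *\<^sub>C h)) \<le> 1 + e * \<bar>t\<bar>" by blast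
qed

lemma hermitian_vector_derivative:
  assumes "\<And>s. hermitian (f s)" and "(f has_vector_derivative D) (at t)"
  shows "hermitian D"
proof (rule hermitian_approx)
  fix e :: real assume "e > 0"
  then obtain d where d: "d > 0"
    "\<And>s. norm (s - t) < d \<Longrightarrow> norm (f s - f t - (s - t) *\<^sub>R D) \<le> e * norm (s - t)"
    using assms(2) unfolding has_vector_derivative_def has_derivative_at_alt by blast
  define r where "r = d / 2"
  have r: "r > 0" "r < d" using d(1) by (auto simp: r_def)
  define k where "k = (1 / r) *\<^sub>R (f (t + r) - f t)"
  have "D - k = (- 1 / r) *\<^sub>R (f (t + r) - f t - r *\<^sub>R D)"
    using r by (simp add: k_def algebra_simps)
  then have "norm (D - k) = norm (f (t + r) - f t - r *\<^sub>R D) / r"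
    using r by simp
  also have "\<dots> \<le> e" using d(2)[of "t + r"] r by (simp add: field_simps)
  finally show "\<exists>k. hermitian k \<and> norm (D - k) \<le> e"
    using assms(1) by (intro exI[of _ k]) (auto simp: k_def intro!: hermitian_scaleR hermitian_diff)
qed

lemma hermitian_conjugate:
  assumes "hermitian h" and "norm y \<le> 1" "norm z \<le> 1" "y * z = 1"
  shows "hermitian (y * h * z)"
  unfolding hermitian_iff_first_order
proof -
  have "norm (1 + t *\<^sub>R (\<i> *\<^sub>C (y * h * z))) \<le> norm (1 + t *\<^sub>R (\<i> *\<^sub>C h))" for t
  proof -
    have "1 + t *\<^sub>R (\<i> *\<^sub>C (y * h * z)) = y * (1 + t *\<^sub>R (\<i> *\<^sub>C h)) * z"
      using assms(4) by (simp add: algebra_simps mult_scaleC_left mult_scaleC_right)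
    also have "norm \<dots> \<le> norm y * norm (1 + t *\<^sub>R (\<i> *\<^sub>C h)) * norm z"
      by (meson norm_mult_ineq mult_right_mono norm_ge_zero order_trans)
    also have "\<dots> \<le> 1 * norm (1 + t *\<^sub>R (\<i> *\<^sub>C h)) * 1"
      using assms(2,3) by (intro mult_mono) auto
    finally show ?thesis by simp
  qed
  then show "\<forall>e>0. \<exists>d>0. \<forall>t. \<bar>t\<bar> < d \<longrightarrow> norm (1 + t *\<^sub>R (\<i> *\<^sub>C (y * h * z))) \<le> 1 + e * \<bar>t\<bar>"
    using assms(1) unfolding hermitian_iff_first_order by (meson order_trans)
qed

text \<open>
  The commutator is the derivative at \<open>s = 0\<close> of the curve \<open>exp (i s h) k exp (- i s h)\<close>, whose values
  are hermitian because conjugating by elements of norm one does not increase \<open>norm (1 + i t k)\<close>.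
\<close>

lemma hermitian_commutator:
  assumes "hermitian h" "hermitian k"
  shows "hermitian (\<i> *\<^sub>C (h * k - k * h))"
proof -
  define x where "x = \<i> *\<^sub>C h"
  have n: "norm (exp (s *\<^sub>R x)) = 1" for s :: real
    using assms(1) by (simp add: hermitian_iff_norm_exp x_def)
  have herm: "hermitian (exp (s *\<^sub>R x) * k * exp (s *\<^sub>R (- x)))" for s :: real
  proof (rule hermitian_conjugate[OF assms(2)])
    show "norm (exp (s *\<^sub>R x)) \<le> 1" "norm (exp (s *\<^sub>R (- x))) \<le> 1"
      using n[of s] n[of "- s"] by simp_all
    show "exp (s *\<^sub>R x) * exp (s *\<^sub>R (- x)) = 1"
      using exp_minus_inverse[of "s *\<^sub>R x"] by simp
  qed
  have "((\<lambda>s. exp (s *\<^sub>R x) * k * exp (s *\<^sub>R (- x))) has_vector_derivative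
      (exp (0 *\<^sub>R x) * k * (exp (0 *\<^sub>R (- x)) * (- x)) + exp (0 *\<^sub>R x) * x * k * exp (0 *\<^sub>R (- x)))) (at 0)"
    by (intro has_vector_derivative_mult has_vector_derivative_mult_left
        exp_scaleR_has_vector_derivative_right)
  from hermitian_vector_derivative[OF herm this] show ?thesis
    by (simp add: x_def mult_scaleC_left mult_scaleC_right scaleC_diff_right)
qed

text \<open>
  Here \<open>exp (i t h) = 1 + i t h\<close>, which has norm one for every \<open>t\<close> only if \<open>h = 0\<close>; \<open>norm (t h) = 3\<close> is
  already impossible.
\<close>

lemma hermitian_square_zero:
  assumes "hermitian h" "h * h = 0"
  shows "h = 0"
proof (rule ccontr)
  assume "h \<noteq> 0"
  define t where "t = 3 / norm h"
  define y where "y = t *\<^sub>R (\<i> *\<^sub>C h)"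
  have "y * y = 0" using assms(2) by (simp add: y_def mult_scaleC_left mult_scaleC_right)
  then have y: "y ^ n = 0" if "n \<ge> 2" for n
    using that by (metis le_iff_add mult_zero_left power2_eq_square power_add)
  have "exp y = (\<Sum>n<2. y ^ n /\<^sub>R fact n)"
    unfolding exp_def by (rule suminf_finite) (auto simp: y)
  then have "exp y = 1 + y" by (simp add: numeral_2_eq_2)
  moreover have "norm (exp y) = 1"
    using assms(1) by (simp add: hermitian_iff_norm_exp y_def)
  ultimately have "norm (1 + y) = 1" by simp
  moreover have "norm y = 3" using \<open>h \<noteq> 0\<close> by (simp add: y_def t_def norm_scaleC)
  ultimately show False using norm_triangle_ineq4[of "1 + y" 1] by simp
qed

text \<open>
  Either equation makes the hermitian element \<open>i (p u - u p)\<close> square to zero: if \<open>p u = u\<close>, then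
  \<open>(u - u p) (u - u p) = u (1 - p) u (1 - p)\<close> and \<open>(1 - p) u = 0\<close>.
\<close>

lemma hermitian_idempotent_absorbs:
  assumes "hermitian p" "p * p = p" "hermitian u"
  shows "p * u = u \<longleftrightarrow> u * p = u"
proof -
  define h where "h = \<i> *\<^sub>C (p * u - u * p)"
  have h: "hermitian h" unfolding h_def using hermitian_commutator assms by blast
  have pp: "p * (p * z) = p * z" for z using assms(2) by (metis mult.assoc)
  have iff: "h = 0 \<longleftrightarrow> p * u = u * p" by (simp add: h_def scaleC_eq_0_iff)
  have "p * u = u * p" if "p * u = u \<or> u * p = u"
  proof -
    have "(p * u - u * p) * (p * u - u * p) = 0"
      using that
    proof
      assume "p * u = u"
      moreover from this have "p * (u * z) = u * z" for z by (metis mult.assoc)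
      ultimately show ?thesis using assms(2) by (simp add: algebra_simps pp)
    next
      assume "u * p = u"
      moreover from this have "u * (p * z) = u * z" for z by (metis mult.assoc)
      ultimately show ?thesis using assms(2) by (simp add: algebra_simps pp)
    qed
    then have "h * h = 0" by (simp add: h_def mult_scaleC_left mult_scaleC_right)
    with h hermitian_square_zero iff show ?thesis by blast
  qed
  then show ?thesis by auto
qed

section \<open>A Liouville theorem for power series\<close>

lemma sum_roots_of_unity:
  fixes w :: complex
  assumes "w ^ N = 1"
  shows "(\<Sum>k<N. w ^ k) = (if w = 1 then of_nat N else 0)"
  using assms by (simp add: sum_gp_strict)

text \<open>
  Liouville's theorem for the linear coefficient, with the Cauchy integral over the circle of radius \<open>r\<close>
  replaced by an average over the \<open>N\<close>-th roots of unity. The weights \<open>w ^ (k (N - 1))\<close>, which equal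
  \<open>w ^ (- k)\<close>, single out the coefficient of degree one among the degrees below \<open>N\<close>; the remaining
  terms contribute a tail that tends to \<open>0\<close> with \<open>N\<close>. Hence \<open>r * norm (c 1) \<le> M\<close> for all \<open>r\<close>.
\<close>

lemma bounded_power_series_coeff_1:
  fixes c :: "nat \<Rightarrow> 'a::complex_banach_algebra_1"
  assumes summ: "\<And>r. r \<ge> 0 \<Longrightarrow> summable (\<lambda>n. r ^ n * norm (c n))"
    and bnd: "\<And>z. norm (\<Sum>n. z ^ n *\<^sub>C c n) \<le> M"
  shows "c 1 = 0"
proof -
  have "r * norm (c 1) \<le> M" if "r > 0" for r :: real
  proof (rule tendsto_lowerbound)
    have S: "summable (\<lambda>n. r ^ n * norm (c n))" using summ that by simp
    show "(\<lambda>N. M + (\<Sum>n. r ^ (n + N) * norm (c (n + N)))) \<longlonglongrightarrow> M"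
      using tendsto_add[OF tendsto_const suminf_exist_split2[OF S]] by simp
    show "\<forall>\<^sub>F N in sequentially. r * norm (c 1) \<le> M + (\<Sum>n. r ^ (n + N) * norm (c (n + N)))"
    proof (rule eventually_sequentiallyI[of 2])
      fix N :: nat assume N: "N \<ge> 2"
      define w where "w = exp (2 * of_real pi * \<i> * of_nat 1 / of_nat N)"
      have wj: "w ^ j = exp (2 * of_real pi * \<i> * of_nat j / of_nat N)" for j
        by (simp add: w_def exp_of_nat_mult[symmetric] field_simps)
      have w1: "w ^ j = 1 \<longleftrightarrow> N dvd j" for j
        unfolding wj using N by (intro complex_root_unity_eq_1) simp
      have nw: "cmod (w ^ j) = 1" for j by (simp add: wj)
      define z where "z k = of_real r * w ^ k" for k
      define f where "f \<zeta> = (\<Sum>n. \<zeta> ^ n *\<^sub>C c n)" for \<zeta>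
      define g where "g \<zeta> = (\<Sum>n<N. \<zeta> ^ n *\<^sub>C c n)" for \<zeta>
      define T where "T = (\<Sum>n. r ^ (n + N) * norm (c (n + N)))"
      have nz: "norm (z k ^ n *\<^sub>C c n) = r ^ n * norm (c n)" for k n
        using that nw[of k] by (simp add: z_def norm_scaleC norm_mult norm_power)
      have g_bound: "norm (g (z k)) \<le> M + T" for k
      proof -
        have Sn: "summable (\<lambda>n. norm (z k ^ n *\<^sub>C c n))" unfolding nz by (rule S)
        then have "summable (\<lambda>n. z k ^ n *\<^sub>C c n)" by (rule summable_norm_cancel)
        from suminf_minus_initial_segment[OF this, of N]
        have "f (z k) - g (z k) = (\<Sum>n. z k ^ (n + N) *\<^sub>C c (n + N))"
          by (simp add: f_def g_def)
        moreover have "norm (\<Sum>n. z k ^ (n + N) *\<^sub>C c (n + N))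
            \<le> (\<Sum>n. norm (z k ^ (n + N) *\<^sub>C c (n + N)))"
          using Sn by (intro summable_norm summable_ignore_initial_segment)
        ultimately have "norm (f (z k) - g (z k)) \<le> T" by (simp add: nz T_def)
        moreover have "norm (f (z k)) \<le> M" unfolding f_def by (rule bnd)
        ultimately show ?thesis
          using norm_triangle_sub[of "g (z k)" "f (z k)"] by (simp add: norm_minus_commute)
      qed
      have coeff: "(\<Sum>k<N. w ^ (k * (N - 1)) * z k ^ n) = (if n = 1 then of_nat N * of_real r else 0)"
        if "n < N" for n
      proof -
        have "w ^ (k * (N - 1)) * z k ^ n = of_real r ^ n * (w ^ (n + (N - 1))) ^ k" for k
          by (simp add: z_def power_mult_distrib power_mult[symmetric] power_add[symmetric]
              algebra_simps)
        moreover have "(w ^ (n + (N - 1))) ^ N = 1"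
          by (simp add: power_mult[symmetric] w1)
        moreover have "N dvd n + (N - 1) \<longleftrightarrow> n = 1"
        proof
          assume "N dvd n + (N - 1)"
          then obtain m where m: "n + (N - 1) = N * m" by (elim dvdE)
          have "N * m < N * 2" "0 < N * m" using m that N by linarith+
          then have "m < 2" "0 < m" by simp_all
          then show "n = 1" using m N by (cases "m = 1") auto
        qed (use N in auto)
        ultimately have "(\<Sum>k<N. w ^ (k * (N - 1)) * z k ^ n)
            = of_real r ^ n * (if n = 1 then of_nat N else 0)"
          by (simp only: sum_distrib_left[symmetric] sum_roots_of_unity w1)
        then show ?thesis by simp
      qed
      have "(\<Sum>k<N. w ^ (k * (N - 1)) *\<^sub>C g (z k))
          = (\<Sum>n<N. (\<Sum>k<N. w ^ (k * (N - 1)) * z k ^ n) *\<^sub>C c n)"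
        unfolding g_def scaleC_sum_right scaleC_sum_left scaleC_scaleC by (rule sum.swap)
      also have "\<dots> = (\<Sum>n<N. if n = 1 then (of_nat N * of_real r) *\<^sub>C c n else 0)"
        by (intro sum.cong refl) (simp only: lessThan_iff coeff split: if_splits, simp)
      also have "\<dots> = (of_nat N * of_real r) *\<^sub>C c 1" using N by simp
      finally have "real N * (r * norm (c 1)) = norm (\<Sum>k<N. w ^ (k * (N - 1)) *\<^sub>C g (z k))"
        using that by (simp add: norm_scaleC norm_mult)
      also have "\<dots> \<le> (\<Sum>k<N. M + T)"
        by (intro sum_norm_le) (simp only: norm_scaleC nw mult_1 g_bound)
      finally show "r * norm (c 1) \<le> M + T" using N by simp
    qed
  qed simp
  then have le: "r * norm (c 1) \<le> M" if "r > 0" for r using that by blast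
  show ?thesis
  proof (rule ccontr)
    assume "c 1 \<noteq> 0"
    then have "(\<bar>M\<bar> + 1) / norm (c 1) * norm (c 1) \<le> M" by (intro le) simp
    with \<open>c 1 \<noteq> 0\<close> show False by simp
  qed
qed

section \<open>Fuglede's theorem\<close>

lemma exp_scaleC_mult_sums:
  fixes s b :: "'a::complex_banach_algebra_1"
  shows "(\<lambda>n. z ^ n *\<^sub>C (s ^ n /\<^sub>R fact n * b)) sums (exp (z *\<^sub>C s) * b)"
    and "(\<lambda>n. z ^ n *\<^sub>C (b * (s ^ n /\<^sub>R fact n))) sums (b * exp (z *\<^sub>C s))"
  using sums_mult2[OF exp_converges[of "z *\<^sub>C s"], of b] sums_mult[OF exp_converges[of "z *\<^sub>C s"], of b]
  by (simp_all add: scaleC_power mult_scaleC_left mult_scaleC_right scaleC_scaleR)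

lemma summable_exp_majorant:
  fixes s b :: "'a::complex_banach_algebra_1"
  assumes "r \<ge> 0" "\<And>n. norm (c n) \<le> norm (s ^ n /\<^sub>R fact n) * norm b"
  shows "summable (\<lambda>n. r ^ n * norm (c n))"
proof (rule summable_comparison_test')
  show "summable (\<lambda>n. norm ((r *\<^sub>R s) ^ n /\<^sub>R fact n) * norm b)"
    by (intro summable_mult2 summable_norm_exp)
  show "norm (r ^ n * norm (c n)) \<le> norm ((r *\<^sub>R s) ^ n /\<^sub>R fact n) * norm b" if "n \<ge> 0" for n
    using mult_left_mono[OF assms(2)[of n], of "r ^ n"] assms(1)
    by (simp add: scaleR_power mult_ac abs_mult)
qed

lemma exp_mult_annihilated:
  fixes x b :: "'a::{real_normed_algebra_1,banach}"
  shows "x * b = 0 \<Longrightarrow> exp x * b = b" and "b * x = 0 \<Longrightarrow> b * exp x = b"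
proof -
  have single: "(\<lambda>n. if n = 0 then b else 0) sums b"
    using sums_single[of 0 "\<lambda>_. b"] by simp
  show "exp x * b = b" if "x * b = 0"
  proof -
    have "x ^ n /\<^sub>R fact n * b = (if n = 0 then b else 0)" for n
      using that by (cases n) (simp_all add: power_Suc2 mult.assoc del: power_Suc)
    then have "(\<lambda>n. if n = 0 then b else 0) sums (exp x * b)"
      using sums_mult2[OF exp_converges[of x], of b] by (simp only:)
    then show ?thesis using single by (rule sums_unique2)
  qed
  show "b * exp x = b" if "b * x = 0"
  proof -
    have "b * (x ^ n /\<^sub>R fact n) = (if n = 0 then b else 0)" for n
      using that by (cases n) (simp_all add: mult.assoc[symmetric])
    then have "(\<lambda>n. if n = 0 then b else 0) sums (b * exp x)"
      using sums_mult[OF exp_converges[of x], of b] by (simp only:)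
    then show ?thesis using single by (rule sums_unique2)
  qed
qed

text \<open>
  The difference \<open>z a\<^sup>* - cnj z a\<close> equals \<open>i\<close> times the hermitian element \<open>2 (Im z) u - 2 (Re z) v\<close>, and
  the exponential splits because \<open>u\<close> and \<open>v\<close> commute.
\<close>

lemma exp_adjoint_factorization:
  fixes u v :: "'a::complex_banach_algebra_1"
  assumes "hermitian u" "hermitian v" "u * v = v * u"
  obtains e where "norm e = 1"
    "exp (z *\<^sub>C (u - \<i> *\<^sub>C v)) = e * exp (cnj z *\<^sub>C (u + \<i> *\<^sub>C v))"
    "exp (z *\<^sub>C (u - \<i> *\<^sub>C v)) = exp (cnj z *\<^sub>C (u + \<i> *\<^sub>C v)) * e"
proof -
  define h where "h = (2 * Im z) *\<^sub>R u - (2 * Re z) *\<^sub>R v"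
  define y where "y = cnj z *\<^sub>C (u + \<i> *\<^sub>C v)"
  have "hermitian h" unfolding h_def by (intro hermitian_diff hermitian_scaleR assms)
  then have "norm (exp (\<i> *\<^sub>C h)) = 1" by (rule hermitian_norm_exp)
  moreover have comm: "\<i> *\<^sub>C h * y = y * \<i> *\<^sub>C h"
    by (simp add: h_def y_def mult_scaleC_left mult_scaleC_right algebra_simps assms(3)
        scaleC_add_right scaleC_diff_right scaleC_scaleR scaleC_scaleC)
  moreover have "z *\<^sub>C (u - \<i> *\<^sub>C v) = \<i> *\<^sub>C h + y"
  proof -
    have "z *\<^sub>C u = (\<i> * of_real (2 * Im z) + cnj z) *\<^sub>C u"
      by (rule arg_cong[where f = "\<lambda>c. c *\<^sub>C u"]) (simp add: complex_eq_iff)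
    moreover have "(z * \<i>) *\<^sub>C v = (\<i> * of_real (2 * Re z) - cnj z * \<i>) *\<^sub>C v"
      by (rule arg_cong[where f = "\<lambda>c. c *\<^sub>C v"]) (simp add: complex_eq_iff)
    ultimately show ?thesis
      by (simp only: h_def y_def scaleC_of_real[symmetric] scaleC_diff_right scaleC_add_right
          scaleC_scaleC scaleC_diff_left scaleC_add_left) (simp add: algebra_simps)
  qed
  ultimately show ?thesis
    using that[of "exp (\<i> *\<^sub>C h)"] exp_add_commuting[of "\<i> *\<^sub>C h" y] exp_add_commuting[of y "\<i> *\<^sub>C h"]
    by (simp add: y_def add.commute)
qed

text \<open>
  If \<open>a b = 0\<close>, then \<open>exp (cnj z a) b = b\<close>, so the factorization bounds the entire function
  \<open>z \<mapsto> exp (z a\<^sup>*) b\<close> by \<open>norm b\<close>. Its linear coefficient \<open>a\<^sup>* b\<close> therefore vanishes.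
\<close>

lemma fuglede_left:
  assumes "hermitian u" "hermitian v" "u * v = v * u" and ann: "(u + \<i> *\<^sub>C v) * b = 0"
  shows "(u - \<i> *\<^sub>C v) * b = 0"
proof -
  define s where "s = u - \<i> *\<^sub>C v"
  have "s ^ 1 /\<^sub>R fact 1 * b = 0"
  proof (rule bounded_power_series_coeff_1[of "\<lambda>n. s ^ n /\<^sub>R fact n * b"])
    show "summable (\<lambda>n. r ^ n * norm (s ^ n /\<^sub>R fact n * b))" if "r \<ge> 0" for r
      using that norm_mult_ineq by (rule summable_exp_majorant)
    fix z
    obtain e where e: "norm e = 1" "exp (z *\<^sub>C s) = e * exp (cnj z *\<^sub>C (u + \<i> *\<^sub>C v))"
      using exp_adjoint_factorization[OF assms(1-3)] unfolding s_def by metis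
    have "exp (cnj z *\<^sub>C (u + \<i> *\<^sub>C v)) * b = b"
      using ann by (intro exp_mult_annihilated) (simp add: mult_scaleC_left)
    then have "exp (z *\<^sub>C s) * b = e * b" by (simp add: e mult.assoc)
    then show "norm (\<Sum>n. z ^ n *\<^sub>C (s ^ n /\<^sub>R fact n * b)) \<le> norm b"
      using norm_mult_ineq[of e b] e(1)
      by (simp only: sums_unique[OF exp_scaleC_mult_sums(1), symmetric])
  qed
  then show ?thesis by (simp add: s_def)
qed

lemma fuglede_right:
  assumes "hermitian u" "hermitian v" "u * v = v * u" and ann: "b * (u + \<i> *\<^sub>C v) = 0"
  shows "b * (u - \<i> *\<^sub>C v) = 0"
proof -
  define s where "s = u - \<i> *\<^sub>C v"
  have "b * (s ^ 1 /\<^sub>R fact 1) = 0"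
  proof (rule bounded_power_series_coeff_1[of "\<lambda>n. b * (s ^ n /\<^sub>R fact n)"])
    show "summable (\<lambda>n. r ^ n * norm (b * (s ^ n /\<^sub>R fact n)))" if "r \<ge> 0" for r
      using that
    proof (rule summable_exp_majorant)
      show "norm (b * (s ^ n /\<^sub>R fact n)) \<le> norm (s ^ n /\<^sub>R fact n) * norm b" for n
        using norm_mult_ineq[of b "s ^ n /\<^sub>R fact n"] by (simp only: mult.commute)
    qed
    fix z
    obtain e where e: "norm e = 1" "exp (z *\<^sub>C s) = exp (cnj z *\<^sub>C (u + \<i> *\<^sub>C v)) * e"
      using exp_adjoint_factorization[OF assms(1-3)] unfolding s_def by metis
    have "b * exp (cnj z *\<^sub>C (u + \<i> *\<^sub>C v)) = b"
      using ann by (intro exp_mult_annihilated) (simp add: mult_scaleC_right)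
    then have "b * exp (z *\<^sub>C s) = b * e" by (simp add: e mult.assoc[symmetric])
    then show "norm (\<Sum>n. z ^ n *\<^sub>C (b * (s ^ n /\<^sub>R fact n))) \<le> norm b"
      using norm_mult_ineq[of b e] e(1)
      by (simp only: sums_unique[OF exp_scaleC_mult_sums(2), symmetric])
  qed
  then show ?thesis by (simp add: s_def)
qed

section \<open>The involution and normality\<close>

lemma cartesian_parts_eq_0:
  fixes u v :: "'a::complex_banach_algebra_1"
  assumes "u + \<i> *\<^sub>C v = 0" "u - \<i> *\<^sub>C v = 0"
  shows "u = 0" "v = 0"
proof -
  have "2 *\<^sub>R u = (u + \<i> *\<^sub>C v) + (u - \<i> *\<^sub>C v)" by (simp add: scaleR_2)
  then show "u = 0" using assms by simp
  with assms(1) show "v = 0" by (simp add: scaleC_eq_0_iff)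
qed

text \<open>
  If \<open>u + i v = 0\<close>, then \<open>u\<close> is a multiple of \<open>v\<close> and commutes with it; Fuglede's theorem with \<open>b = 1\<close>
  gives \<open>u - i v = 0\<close> as well.
\<close>

lemma hermitian_parts_zero:
  assumes "hermitian u" "hermitian v" "u + \<i> *\<^sub>C v = 0"
  shows "u = 0" "v = 0"
proof -
  have "u = - (\<i> *\<^sub>C v)" using assms(3) by (simp add: eq_neg_iff_add_eq_0)
  then have "u * v = v * u" by (simp add: mult_scaleC_left mult_scaleC_right)
  from fuglede_left[OF assms(1,2) this, of 1] assms(3) have "u - \<i> *\<^sub>C v = 0" by simp
  with assms(3) cartesian_parts_eq_0 show "u = 0" "v = 0" by blast+
qed

lemma hermitian_parts_unique:
  assumes "hermitian u" "hermitian v" "hermitian u'" "hermitian v'"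
    and "u + \<i> *\<^sub>C v = u' + \<i> *\<^sub>C v'"
  shows "u = u'" "v = v'"
proof -
  have "(u - u') + \<i> *\<^sub>C (v - v') = 0" using assms(5) by (simp add: scaleC_diff_right algebra_simps)
  from hermitian_parts_zero[OF hermitian_diff[OF assms(1,3)] hermitian_diff[OF assms(2,4)] this]
  show "u = u'" "v = v'" by simp_all
qed

lemma star_eq:
  assumes "hermitian u" "hermitian v"
  shows "star (u + \<i> *\<^sub>C v) = u - \<i> *\<^sub>C v"
  unfolding star_def
proof (rule the_equality)
  show "\<exists>u' v'. hermitian u' \<and> hermitian v' \<and> u + \<i> *\<^sub>C v = u' + \<i> *\<^sub>C v' \<and>
      u - \<i> *\<^sub>C v = u' - \<i> *\<^sub>C v'"
    using assms by blast
qed (use assms hermitian_parts_unique in blast)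

lemma normal_element_iff:
  assumes "hermitian u" "hermitian v"
  shows "normal_element (u + \<i> *\<^sub>C v) \<longleftrightarrow> u * v = v * u"
  unfolding normal_element_def using assms hermitian_parts_unique by blast

lemma commute_iff_star_commute:
  fixes u v :: "'a::complex_banach_algebra_1"
  shows "u * v = v * u \<longleftrightarrow>
    (u + \<i> *\<^sub>C v) * (u - \<i> *\<^sub>C v) = (u - \<i> *\<^sub>C v) * (u + \<i> *\<^sub>C v)"
proof -
  have "(u + \<i> *\<^sub>C v) * (u - \<i> *\<^sub>C v) - (u - \<i> *\<^sub>C v) * (u + \<i> *\<^sub>C v)
      = 2 *\<^sub>R (\<i> *\<^sub>C (v * u - u * v))"
    by (simp add: algebra_simps mult_scaleC_left mult_scaleC_right scaleC_diff_right scaleC_add_right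
        scaleR_2)
  moreover have "2 *\<^sub>R (\<i> *\<^sub>C (v * u - u * v)) = 0 \<longleftrightarrow> v * u - u * v = 0"
    by (simp only: scaleR_eq_0_iff scaleC_eq_0_iff) simp
  ultimately show ?thesis by (metis eq_iff_diff_eq_0)
qed

text \<open>Up to the factor \<open>i\<close>, the commutators of \<open>p\<close> with \<open>u\<close> and \<open>v\<close> are hermitian parts of \<open>0\<close>.\<close>

lemma hermitian_commute_parts:
  assumes "hermitian p" "hermitian u" "hermitian v"
    and "p * (u + \<i> *\<^sub>C v) = (u + \<i> *\<^sub>C v) * p"
  shows "p * u = u * p" "p * v = v * p"
proof -
  have "\<i> *\<^sub>C (p * u - u * p) + \<i> *\<^sub>C (\<i> *\<^sub>C (p * v - v * p))
      = \<i> *\<^sub>C (p * (u + \<i> *\<^sub>C v) - (u + \<i> *\<^sub>C v) * p)"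
    by (simp add: algebra_simps mult_scaleC_left mult_scaleC_right scaleC_diff_right scaleC_add_right)
  also have "\<dots> = 0" using assms(4) by simp
  finally have "\<i> *\<^sub>C (p * u - u * p) + \<i> *\<^sub>C (\<i> *\<^sub>C (p * v - v * p)) = 0" .
  from hermitian_parts_zero[OF hermitian_commutator[OF assms(1,2)] hermitian_commutator[OF assms(1,3)] this]
  show "p * u = u * p" "p * v = v * p" by (simp_all add: scaleC_eq_0_iff)
qed

section \<open>Moore-Penrose inverses\<close>

lemma is_MP_inverseD:
  assumes "is_MP_inverse a x"
  shows "a * x * a = a" "x * a * x = x" "hermitian (a * x)" "hermitian (x * a)"
proof -
  note conj = assms[unfolded is_MP_inverse_def]
  show "a * x * a = a" by (rule conj[THEN conjunct1, symmetric])
  show "x * a * x = x" by (rule conj[THEN conjunct2, THEN conjunct1, symmetric])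
  show "hermitian (a * x)" "hermitian (x * a)" using conj by simp_all
qed

text \<open>
  For inverses \<open>x\<close> and \<open>y\<close>, each of the projections \<open>a x\<close>, \<open>a y\<close> absorbs the other from the left.
  Absorption passes to the other side by \<open>hermitian_idempotent_absorbs\<close>, so the two are equal; the same
  holds for \<open>x a\<close> and \<open>y a\<close>.
\<close>

lemma is_MP_inverse_unique:
  assumes x: "is_MP_inverse a x" and y: "is_MP_inverse a y"
  shows "x = y"
proof -
  note ax = is_MP_inverseD[OF x] and ay = is_MP_inverseD[OF y]
  have absorb: "(a * z) * (a * w) = a * w" "(w * a) * (z * a) = w * a" if "a * z * a = a" for z w
    using that by (simp_all only: mult.assoc[symmetric]) (simp only: mult.assoc)
  have 1: "a * x = a * y"
    using hermitian_idempotent_absorbs[OF ax(3) absorb(1)[OF ax(1)] ay(3)]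
      absorb(1)[OF ax(1), of y] absorb(1)[OF ay(1), of x] by simp
  have 2: "x * a = y * a"
    using hermitian_idempotent_absorbs[OF ay(4) absorb(2)[OF ay(1)] ax(4)]
      absorb(2)[OF ay(1), of x] absorb(2)[OF ax(1), of y] by simp
  have "x = x * a * x" by (simp only: ax(2))
  also have "\<dots> = y * (a * x)" by (simp only: 2 mult.assoc[symmetric])
  also have "\<dots> = y * a * y" by (simp only: 1 mult.assoc)
  finally show ?thesis by (simp only: ay(2))
qed

lemma MP_inverse_eq: "is_MP_inverse a x \<Longrightarrow> a\<^sup>\<dagger> = x"
  unfolding MP_inverse_def using is_MP_inverse_unique by blast

text \<open>
  Fuglede's theorem moves \<open>a (1 - q) = 0\<close> and \<open>(1 - p) a = 0\<close> from \<open>a\<close> to its hermitian parts, where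
  absorption can change sides. This gives \<open>q a = a\<close> and \<open>a p = a\<close>, so each of the idempotents
  \<open>p = a x\<close> and \<open>q = x a\<close> equals \<open>q p\<close>.
\<close>

lemma normal_imp_range_projections_eq:
  assumes "hermitian u" "hermitian v" "u * v = v * u" and x: "is_MP_inverse (u + \<i> *\<^sub>C v) x"
  shows "(u + \<i> *\<^sub>C v) * x = x * (u + \<i> *\<^sub>C v)"
proof -
  define a where "a = u + \<i> *\<^sub>C v"
  define p where "p = a * x"
  define q where "q = x * a"
  note ax = is_MP_inverseD[OF x, folded a_def]
  have herm: "hermitian p" "hermitian q" unfolding p_def q_def by (fact ax)+
  have pa: "p * a = a" and aq: "a * q = a"
    using ax(1) by (simp_all only: p_def q_def mult.assoc)
  have pq: "p * p = p" "q * q = q" "p * a = a" "a * q = a"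
    using pa aq by (simp_all only: p_def q_def mult.assoc[symmetric]) (simp_all only: mult.assoc)
  have "(u + \<i> *\<^sub>C v) * (1 - q) = 0" using pq by (simp add: algebra_simps flip: a_def)
  moreover from this have "(u - \<i> *\<^sub>C v) * (1 - q) = 0" by (rule fuglede_left[OF assms(1-3)])
  ultimately have "u * (1 - q) = 0" "v * (1 - q) = 0"
    using cartesian_parts_eq_0[of "u * (1 - q)" "v * (1 - q)"]
    by (simp_all only: distrib_right left_diff_distrib mult_scaleC_left)
  then have "u * q = u" "v * q = v" by (simp_all add: right_diff_distrib)
  then have "q * u = u" "q * v = v"
    using hermitian_idempotent_absorbs[OF herm(2) pq(2)] assms(1,2) by blast+
  then have qa: "q * a = a" by (simp add: a_def distrib_left mult_scaleC_right)
  have "(1 - p) * (u + \<i> *\<^sub>C v) = 0" using pq by (simp add: algebra_simps flip: a_def)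
  moreover from this have "(1 - p) * (u - \<i> *\<^sub>C v) = 0" by (rule fuglede_right[OF assms(1-3)])
  ultimately have "(1 - p) * u = 0" "(1 - p) * v = 0"
    using cartesian_parts_eq_0[of "(1 - p) * u" "(1 - p) * v"]
    by (simp_all only: distrib_left right_diff_distrib mult_scaleC_right)
  then have "p * u = u" "p * v = v" by (simp_all add: left_diff_distrib)
  then have "u * p = u" "v * p = v"
    using hermitian_idempotent_absorbs[OF herm(1) pq(1)] assms(1,2) by blast+
  then have ap: "a * p = a" by (simp add: a_def distrib_right mult_scaleC_left)
  have "p = q * p" using qa by (simp only: p_def mult.assoc[symmetric])
  also have "\<dots> = q" using ap by (simp only: q_def mult.assoc)
  finally show ?thesis unfolding p_def q_def a_def .
qed

theorem theorem3p3:
  fixes a :: "'a::complex_banach_algebra_1"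
  assumes "a \<in> \<V>" and "MP_invertible a"
  shows "normal_element a \<longleftrightarrow> EP a \<and> a\<^sup>\<dagger> * star a = star a * a\<^sup>\<dagger>"
proof -
  obtain u v where uv: "hermitian u" "hermitian v" and a: "a = u + \<i> *\<^sub>C v"
    using assms(1) unfolding hermitian_span_def by blast
  obtain x where x: "is_MP_inverse a x" using assms(2) unfolding MP_invertible_def by blast
  have dag: "a\<^sup>\<dagger> = x" using x by (rule MP_inverse_eq)
  define s where "s = star a"
  have s: "s = u - \<i> *\<^sub>C v" unfolding s_def a using uv by (rule star_eq)
  have normal: "normal_element a \<longleftrightarrow> a * s = s * a"
    unfolding s a normal_element_iff[OF uv] by (rule commute_iff_star_commute)
  note ax = is_MP_inverseD[OF x]
  have proj_star: "a * x * s = s * (a * x)" if "a * x = x * a"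
  proof -
    have "a * x * a = a * (x * a)" by (rule mult.assoc)
    then have "a * x * a = a * (a * x)" by (simp only: that)
    then have "a * x * u = u * (a * x)" "a * x * v = v * (a * x)"
      using hermitian_commute_parts[OF ax(3) uv] unfolding a by blast+
    then show ?thesis by (simp add: s left_diff_distrib right_diff_distrib mult_scaleC_left mult_scaleC_right)
  qed
  \<comment> \<open>When \<open>a x = x a\<close>, both \<open>a\<close> and \<open>x\<close> live in the corner of this idempotent and are inverse there.\<close>
  have key: "a * s = s * a \<longleftrightarrow> x * s = s * x" if ep: "a * x = x * a"
  proof
    assume as: "a * s = s * a"
    have "x * s = x * (a * x * s)" using ax(2) by (simp add: mult.assoc[symmetric])
    also have "\<dots> = x * s * a * x" using proj_star[OF ep] by (simp add: mult.assoc)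
    also have "\<dots> = x * a * s * x" using as by (simp add: mult.assoc)
    also have "\<dots> = a * x * s * x" using ep by simp
    also have "\<dots> = s * (a * x) * x" using proj_star[OF ep] by simp
    also have "\<dots> = s * (x * a * x)" using ep by (simp add: mult.assoc)
    finally show "x * s = s * x" using ax(2) by simp
  next
    assume xs: "x * s = s * x"
    have "a * s = a * x * a * s" by (simp only: ax(1))
    also have "\<dots> = a * (x * a * s)" by (simp only: mult.assoc)
    also have "\<dots> = a * (a * x * s)" by (simp only: ep)
    also have "\<dots> = a * (s * (x * a))" by (simp only: proj_star[OF ep]) (simp only: ep)
    also have "\<dots> = a * s * x * a" by (simp only: mult.assoc)
    also have "\<dots> = a * x * s * a" using xs by (simp add: mult.assoc)
    also have "\<dots> = s * (a * x * a)" using proj_star[OF ep] by (simp add: mult.assoc)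
    finally show "a * s = s * a" using ax(1) by simp
  qed
  have "a * x = x * a" if "normal_element a"
    using that normal_imp_range_projections_eq[OF uv] x unfolding a normal_element_iff[OF uv] by blast
  then show ?thesis
    using normal key assms(2) unfolding EP_def dag s_def by blast
qed

end
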